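(* For integers $r,p$ with $r\ge 0$ and every integer $n\ge0$, $$\beta_{n,\lambda}^{(p)}(-r)=(-1)^{n}\sum_{k=0}^{n}\frac{\lambda^{k}(1)_{k+1,1/\lambda}}{(k+1)^{p}}\sum_{j=0}^{n}\binom{n}{j}S_{2,\lambda}(j,k)(r)_{n-j,\lambda}=(-1)^{n}\sum_{k=0}^{n}\frac{\lambda^{k}(1)_{k+1,1/\lambda}}{(k+1)^{p}}S_{2,\lambda}^{(r)}(n+r,k+r).$$
   Context: Let $\lambda$ be a nonzero real number. For $\mu\in\mathbb{R}$, $(x)_{0,\mu}=1$, $(x)_{n,\mu}=x(x-\mu)\cdots(x-(n-1)\mu)$ for $n\ge1$, and $e_\mu^x(t)=\sum_{k\ge0}(x)_{k,\mu}t^k/k!$ (formal power series in $t$), $e_\mu(t)=e_\mu^1(t)$; $(x)_k=x(x-1)\cdots(x-k+1)$. The degenerate Stirling numbers of the second kind are defined by $(x)_{n,\lambda}=\sum_{k=0}^n S_{2,\lambda}(n,k)(x)_k$ (with $S_{2,\lambda}(n,k)=0$ for $k>n$), and for an integer $r\ge0$ the degenerate $r$-Stirling numbers of the second kind by $(x+r)_{n,\lambda}=\sum_{k=0}^n S^{(r)}_{2,\lambda}(n+r,k+r)(x)_k$. For $k\in\mathbb{Z}$, the degenerate polylogarithm is $\mathrm{Li}_{k,\lambda}(y)=\sum_{n\ge1}\frac{(-\lambda)^{n-1}(1)_{n,1/\lambda}}{(n-1)!\,n^k}y^n$. The degenerate poly-Bernoulli polynomials of index $k$ are defined by $\frac{\mathrm{Li}_{k,\lambda}(1-e_\lambda(-t))}{1-e_\lambda(-t)}e_\lambda^{-x}(-t)=\sum_{n\ge0}\beta^{(k)}_{n,\lambda}(x)\frac{t^n}{n!}$.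 *)

theory Defs
  imports Complex_Main "HOL-Computational_Algebra.Formal_Power_Series"
begin

definition deg_ffact :: "real \<Rightarrow> real \<Rightarrow> nat \<Rightarrow> real" where
  "deg_ffact \<mu> x n = (\<Prod>i<n. x - real i * \<mu>)"

definition fall_fact :: "real \<Rightarrow> nat \<Rightarrow> real" where
  "fall_fact x k = (\<Prod>i<k. x - real i)"

definition deg_exp :: "real \<Rightarrow> real \<Rightarrow> real fps" where
  "deg_exp \<mu> x = Abs_fps (\<lambda>k. deg_ffact \<mu> x k / fact k)"

text \<open>
  The numbers are given implicitly, as connection coefficients; the lemmas
  \<open>ex1_deg_Stirling2\<close> and \<open>ex1_deg_rStirling2\<close> show that the
  descriptions determine exactly one family each.
\<close>

definition is_deg_Stirling2 :: "real \<Rightarrow> (nat \<Rightarrow> nat \<Rightarrow> real) \<Rightarrow> bool" where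
  "is_deg_Stirling2 l S \<longleftrightarrow>
     (\<forall>n x. deg_ffact l x n = (\<Sum>k=0..n. S n k * fall_fact x k)) \<and>
     (\<forall>n k. k > n \<longrightarrow> S n k = 0)"

definition deg_Stirling2 :: "real \<Rightarrow> nat \<Rightarrow> nat \<Rightarrow> real" where
  "deg_Stirling2 l = (THE S. is_deg_Stirling2 l S)"

text \<open>
  The arguments of the \<open>r\<close>-Stirling numbers are the shifted ones
  \<open>(n + r, k + r)\<close>; values outside \<open>r \<le> K \<le> N\<close> are set to zero.
\<close>

definition is_deg_rStirling2 :: "real \<Rightarrow> nat \<Rightarrow> (nat \<Rightarrow> nat \<Rightarrow> real) \<Rightarrow> bool" where
  "is_deg_rStirling2 l r S \<longleftrightarrow>
     (\<forall>n x. deg_ffact l (x + real r) n = (\<Sum>k=0..n. S (n + r) (k + r) * fall_fact x k)) \<and>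
     (\<forall>N K. \<not> (r \<le> K \<and> K \<le> N) \<longrightarrow> S N K = 0)"

definition deg_rStirling2 :: "real \<Rightarrow> nat \<Rightarrow> nat \<Rightarrow> nat \<Rightarrow> real" where
  "deg_rStirling2 l r = (THE S. is_deg_rStirling2 l r S)"

definition deg_polylog :: "int \<Rightarrow> real \<Rightarrow> real fps" where
  "deg_polylog k l = Abs_fps (\<lambda>n. if n = 0 then 0 else
     (- l) ^ (n - 1) * deg_ffact (1 / l) 1 n / (fact (n - 1) * real n powi k))"

text \<open>
  Division of power series is exact here: see \<open>deg_polylog_quotient\<close>.
\<close>

definition deg_poly_Bernoulli_gf :: "int \<Rightarrow> real \<Rightarrow> real \<Rightarrow> real fps" where
  "deg_poly_Bernoulli_gf k l x =
     (let u = 1 - (deg_exp l 1 oo (- fps_X))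
      in (deg_polylog k l oo u) / u * (deg_exp l (- x) oo (- fps_X)))"

definition deg_poly_Bernoulli :: "int \<Rightarrow> real \<Rightarrow> nat \<Rightarrow> real \<Rightarrow> real" where
  "deg_poly_Bernoulli k l n x = fact n * fps_nth (deg_poly_Bernoulli_gf k l x) n"

lemma fall_fact_Suc: "fall_fact x (Suc k) = (x - real k) * fall_fact x k"
  by (simp add: fall_fact_def mult.commute)

lemma fall_fact_eq_0: "m < k \<Longrightarrow> fall_fact (real m) k = 0"
  by (auto simp: fall_fact_def)

lemma fall_fact_self: "fall_fact (real m) m \<noteq> 0"
  by (auto simp: fall_fact_def)

lemma fall_fact_coeffs_unique:
  assumes "\<And>x. (\<Sum>k=0..n. a k * fall_fact x k) = (\<Sum>k=0..n. b k * fall_fact x k)"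
    and "k \<le> n"
  shows "a k = b k"
  using assms(2)
proof (induction k rule: less_induct)
  case (less m)
  have split: "(\<Sum>k=0..n. c k * fall_fact (real m) k) =
      (\<Sum>k<m. c k * fall_fact (real m) k) + c m * fall_fact (real m) m" for c :: "nat \<Rightarrow> real"
  proof -
    have "(\<Sum>k=0..n. c k * fall_fact (real m) k) = (\<Sum>k\<le>m. c k * fall_fact (real m) k)"
      using less.prems by (intro sum.mono_neutral_right) (auto simp: fall_fact_eq_0)
    also have "{..m} = insert m {..<m}" by auto
    finally show ?thesis by simp
  qed
  have "(\<Sum>k<m. a k * fall_fact (real m) k) = (\<Sum>k<m. b k * fall_fact (real m) k)"
    using less by (intro sum.cong) auto
  with assms(1)[of "real m"] show ?case
    unfolding split by (simp add: fall_fact_self)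
qed

fun rStir :: "real \<Rightarrow> real \<Rightarrow> nat \<Rightarrow> nat \<Rightarrow> real" where
  "rStir l r 0 k = (if k = 0 then 1 else 0)"
| "rStir l r (Suc n) k =
     (if k = 0 then 0 else rStir l r n (k - 1)) + (real k + r - real n * l) * rStir l r n k"

lemma rStir_eq_0: "n < k \<Longrightarrow> rStir l r n k = 0"
  by (induction n arbitrary: k) auto

lemma rStir_expand: "deg_ffact l (x + r) n = (\<Sum>k=0..n. rStir l r n k * fall_fact x k)"
proof (induction n)
  case 0
  show ?case by (simp add: deg_ffact_def fall_fact_def)
next
  case (Suc n)
  have "(\<Sum>k=0..Suc n. rStir l r (Suc n) k * fall_fact x k) =
     (\<Sum>k=0..Suc n. (if k = 0 then 0 else rStir l r n (k - 1)) * fall_fact x k) +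
     (\<Sum>k=0..Suc n. (real k + r - real n * l) * rStir l r n k * fall_fact x k)"
    unfolding sum.distrib[symmetric] by (intro sum.cong) (auto simp: algebra_simps)
  also have "(\<Sum>k=0..Suc n. (if k = 0 then 0 else rStir l r n (k - 1)) * fall_fact x k) =
      (\<Sum>k=0..n. rStir l r n k * fall_fact x (Suc k))"
    by (subst sum.atLeast0_atMost_Suc_shift) simp
  also have "(\<Sum>k=0..Suc n. (real k + r - real n * l) * rStir l r n k * fall_fact x k) =
      (\<Sum>k=0..n. (real k + r - real n * l) * rStir l r n k * fall_fact x k)"
    by (simp add: rStir_eq_0)
  also have "(\<Sum>k=0..n. rStir l r n k * fall_fact x (Suc k)) + \<dots> =
      (x + r - real n * l) * (\<Sum>k=0..n. rStir l r n k * fall_fact x k)"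
    unfolding sum.distrib[symmetric] sum_distrib_left
    by (intro sum.cong) (auto simp: fall_fact_Suc algebra_simps)
  also have "\<dots> = deg_ffact l (x + r) (Suc n)"
    unfolding Suc.IH[symmetric] by (simp add: deg_ffact_def)
  finally show ?case ..
qed

lemma ex1_deg_Stirling2: "\<exists>!S. is_deg_Stirling2 l S"
proof (rule ex_ex1I)
  show "\<exists>S. is_deg_Stirling2 l S"
    using rStir_expand[of l _ 0] rStir_eq_0
    by (intro exI[of _ "rStir l 0"]) (auto simp: is_deg_Stirling2_def)
next
  fix S T
  assume S: "is_deg_Stirling2 l S" and T: "is_deg_Stirling2 l T"
  show "S = T"
  proof (intro ext)
    fix n k
    show "S n k = T n k"
    proof (cases "k \<le> n")
      case True
      then show ?thesis
        using S T fall_fact_coeffs_unique[where n = n and a = "S n" and b = "T n" and k = k]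
        by (simp add: is_deg_Stirling2_def)
    next
      case False
      then show ?thesis using S T by (simp add: is_deg_Stirling2_def)
    qed
  qed
qed

lemma ex1_deg_rStirling2: "\<exists>!S. is_deg_rStirling2 l r S"
proof (rule ex_ex1I)
  have "is_deg_rStirling2 l r
      (\<lambda>N K. if r \<le> K \<and> K \<le> N then rStir l (real r) (N - r) (K - r) else 0)"
    unfolding is_deg_rStirling2_def by (auto simp: rStir_expand intro!: sum.cong)
  then show "\<exists>S. is_deg_rStirling2 l r S" by blast
next
  fix S T
  assume S: "is_deg_rStirling2 l r S" and T: "is_deg_rStirling2 l r T"
  show "S = T"
  proof (intro ext)
    fix N K
    show "S N K = T N K"
    proof (cases "r \<le> K \<and> K \<le> N")
      case True
      define n k where "n = N - r" and "k = K - r"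
      have "k \<le> n" using True by (auto simp: n_def k_def)
      then have "S (n + r) (k + r) = T (n + r) (k + r)"
        using S T
          fall_fact_coeffs_unique[where n = n and k = k
            and a = "\<lambda>k. S (n + r) (k + r)" and b = "\<lambda>k. T (n + r) (k + r)"]
        by (simp add: is_deg_rStirling2_def)
      with True show ?thesis by (simp add: n_def k_def)
    next
      case False
      then show ?thesis using S T by (auto simp: is_deg_rStirling2_def)
    qed
  qed
qed

lemma deg_polylog_quotient:
  fixes l :: real
  defines "u \<equiv> 1 - (deg_exp l 1 oo (- fps_X))"
  shows "(deg_polylog k l oo u) / u * u = deg_polylog k l oo u"
proof -
  have e: "fps_nth (deg_exp l 1 oo (- fps_X)) n = (- 1) ^ n * deg_ffact l 1 n / fact n" for n
    by (simp add: fps_compose_uminus' deg_exp_def)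
  have u0: "fps_nth u 0 = 0" and u1: "fps_nth u 1 = 1"
    unfolding u_def fps_sub_nth e by (simp_all add: deg_ffact_def)
  have nz: "u \<noteq> 0" using u1 by auto
  have sub: "subdegree u = 1"
    using u0 u1 by (intro subdegreeI) auto
  have "fps_nth (deg_polylog k l oo u) 0 = 0"
    by (simp add: deg_polylog_def fps_compose_nth)
  then have "deg_polylog k l oo u = 0 \<or> subdegree (deg_polylog k l oo u) \<ge> 1"
    by (metis less_one not_le nth_subdegree_nonzero)
  then have "u dvd (deg_polylog k l oo u)"
    using nz sub by (cases "deg_polylog k l oo u = 0") (auto simp: fps_dvd_iff)
  then show ?thesis by simp
qed

end

theory Submission
  imports Defs
begin

text \<open>
  Put \<open>e = deg_exp l 1\<close>. Since \<open>(1 + l t) d/dt\<close> multiplies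
  \<open>deg_exp l x\<close> by \<open>x\<close>, the series \<open>F\<^sub>k = (e - 1)\<^sup>k / k! * deg_exp l x\<close>
  satisfies \<open>(1 + l t) F\<^sub>k' = F\<^sub>k\<^sub>-\<^sub>1 + (k + x) F\<^sub>k\<close>, which on coefficients is the
  recurrence of the degenerate Stirling numbers (\<open>x = 0\<close>) and
  \<open>r\<close>-Stirling numbers (\<open>x = r\<close>). Cancelling \<open>u = 1 - e(-t)\<close> in the
  generating function of the poly-Bernoulli polynomials leaves a power series in \<open>u\<close> times
  \<open>deg_exp l r\<close> at \<open>-t\<close>, that is, a combination of the \<open>F\<^sub>k(-t)\<close>.
\<close>

text \<open>Trades the definite description for a recursion that can be matched with coefficients of
  power series.\<close>

lemma deg_Stirling2_eq_rStir: "deg_Stirling2 l = rStir l 0"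
  unfolding deg_Stirling2_def
proof (rule the1_equality[OF ex1_deg_Stirling2])
  show "is_deg_Stirling2 l (rStir l 0)"
    using rStir_expand[of l _ 0] rStir_eq_0 by (auto simp: is_deg_Stirling2_def)
qed

lemma deg_rStirling2_eq_rStir:
  assumes "k \<le> n"
  shows "deg_rStirling2 l r (n + r) (k + r) = rStir l (real r) n k"
proof -
  let ?S = "\<lambda>N K. if r \<le> K \<and> K \<le> N then rStir l (real r) (N - r) (K - r) else 0"
  have "is_deg_rStirling2 l r ?S"
    unfolding is_deg_rStirling2_def by (auto simp: rStir_expand intro!: sum.cong)
  then have "deg_rStirling2 l r = ?S"
    unfolding deg_rStirling2_def by (rule the1_equality[OF ex1_deg_rStirling2])
  with assms show ?thesis by simp
qed

lemma deg_exp_nth_0 [simp]: "fps_nth (deg_exp l x) 0 = 1"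
  by (simp add: deg_exp_def deg_ffact_def)

text \<open>Coefficientwise this is
  \<open>deg_ffact l x (Suc n) = (x - real n * l) * deg_ffact l x n\<close>.\<close>

lemma deg_exp_ODE:
  "(1 + fps_const l * fps_X) * fps_deriv (deg_exp l x) = fps_const x * deg_exp l x"
proof (rule fps_ext)
  fix n
  have Suc: "real (Suc n) * fps_nth (deg_exp l x) (Suc n) =
      (x - real n * l) * fps_nth (deg_exp l x) n" for n
    by (simp add: deg_exp_def deg_ffact_def divide_simps del: of_nat_Suc)
  show "fps_nth ((1 + fps_const l * fps_X) * fps_deriv (deg_exp l x)) n =
      fps_nth (fps_const x * deg_exp l x) n"
    using Suc[of n] by (cases n) (simp_all add: algebra_simps mult.assoc)
qed

text \<open>Here \<open>F\<close> is not divided by \<open>fact k\<close>, hence the factor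
  \<open>of_nat k\<close>; at \<open>k = 0\<close> it also kills the term with the truncated index
  \<open>k - 1\<close>.\<close>

lemma deg_exp_minus_one_power_ODE:
  fixes l x :: real
  defines "F \<equiv> \<lambda>k. (deg_exp l 1 - 1) ^ k * deg_exp l x"
  shows "(1 + fps_const l * fps_X) * fps_deriv (F k) =
    of_nat k * F (k - 1) + fps_const (real k + x) * F k"
proof -
  let ?e = "deg_exp l 1" and ?d = "1 + fps_const l * fps_X"
  have "?d * fps_deriv (F k) =
      of_nat k * (?e - 1) ^ (k - 1) * (?d * fps_deriv ?e) * deg_exp l x +
      (?e - 1) ^ k * (?d * fps_deriv (deg_exp l x))"
    by (simp add: F_def fps_deriv_power algebra_simps fps_of_nat)
  also have "\<dots> = of_nat k * (?e - 1) ^ (k - 1) * ?e * deg_exp l x + fps_const x * F k"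
    unfolding deg_exp_ODE by (simp add: F_def mult_ac)
  \<comment> \<open>Split the factor \<open>?e\<close> as \<open>(?e - 1) + 1\<close>.\<close>
  also have "of_nat k * (?e - 1) ^ (k - 1) * ?e * deg_exp l x =
      of_nat k * F (k - 1) + of_nat k * F k"
    by (cases k) (simp_all add: F_def algebra_simps)
  finally show ?thesis
    by (simp add: fps_of_nat[symmetric] algebra_simps flip: fps_const_add)
qed

text \<open>Coefficient \<open>n\<close> of the differential equation is the recursion of
  \<open>rStir\<close>; \<open>k\<close> stays arbitrary because the recursion reaches
  \<open>k - 1\<close>.\<close>

lemma deg_exp_minus_one_power_nth:
  "fps_nth ((deg_exp l 1 - 1) ^ k * deg_exp l x) n = fact k * rStir l x n k / fact n"
proof (induction n arbitrary: k)
  case 0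
  show ?case by (simp add: power_0_left)
next
  case (Suc n)
  define F where "F k = (deg_exp l 1 - 1) ^ k * deg_exp l x" for k
  have F: "fps_nth (F k) n = fact k * rStir l x n k / fact n" for k
    using Suc.IH by (simp add: F_def)
  have "fps_nth ((1 + fps_const l * fps_X) * fps_deriv (F k)) n =
      fps_nth (of_nat k * F (k - 1) + fps_const (real k + x) * F k) n"
    using deg_exp_minus_one_power_ODE[where l = l and x = x and k = k] by (simp add: F_def)
  moreover have "fps_nth ((1 + fps_const l * fps_X) * fps_deriv (F k)) n =
      real (Suc n) * fps_nth (F k) (Suc n) + l * real n * fps_nth (F k) n"
    by (cases n) (simp_all add: algebra_simps mult.assoc)
  moreover have "fps_nth (of_nat k * F (k - 1) + fps_const (real k + x) * F k) n =
      real k * fps_nth (F (k - 1)) n + (real k + x) * fps_nth (F k) n"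
    by (simp flip: fps_of_nat)
  ultimately have "real (Suc n) * fps_nth (F k) (Suc n) =
      real k * fps_nth (F (k - 1)) n + (real k + x - real n * l) * fps_nth (F k) n"
    by (simp add: algebra_simps)
  also have "\<dots> = fact k * rStir l x (Suc n) k / fact n"
    unfolding F by (cases k) (simp_all add: field_simps)
  finally show ?case
    unfolding F_def by (simp add: divide_simps mult_ac del: of_nat_Suc rStir.simps)
qed

text \<open>Multiplying the series for \<open>x = 0\<close> by \<open>deg_exp l x\<close> gives the
  series for \<open>x\<close>; a product of exponential generating functions is a binomial
  convolution.\<close>

lemma rStir_eq_sum_binomial:
  "rStir l x n k = (\<Sum>j=0..n. real (n choose j) * rStir l 0 j k * deg_ffact l x (n - j))"
proof -
  have e0: "deg_exp l 0 = 1"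
    by (rule fps_ext) (auto simp: deg_exp_def deg_ffact_def)
  have "fact k * rStir l x n k / fact n =
      (\<Sum>j=0..n. fact k * rStir l 0 j k / fact j * (deg_ffact l x (n - j) / fact (n - j)))"
    using deg_exp_minus_one_power_nth[of l k x n] deg_exp_minus_one_power_nth[of l k 0]
    by (simp add: e0 fps_mult_nth) (simp add: deg_exp_def mult.commute)
  also have "\<dots> = fact k / fact n *
      (\<Sum>j=0..n. real (n choose j) * rStir l 0 j k * deg_ffact l x (n - j))"
    unfolding sum_distrib_left
    by (intro sum.cong) (auto simp: binomial_fact field_simps)
  finally show ?thesis by (simp add: field_simps)
qed

text \<open>Since \<open>b ^ k\<close> has order at least \<open>k\<close>, one range
  \<open>0..n\<close> of \<open>k\<close> serves all coefficients up to \<open>n\<close>, and the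
  sums can be swapped.\<close>

lemma fps_compose_mult_nth:
  fixes a b c :: "'a :: idom fps"
  assumes "fps_nth b 0 = 0"
  shows "fps_nth ((a oo b) * c) n = (\<Sum>k=0..n. fps_nth a k * fps_nth (b ^ k * c) n)"
proof -
  have "fps_nth (a oo b) i = (\<Sum>k=0..n. fps_nth a k * fps_nth (b ^ k) i)" if "i \<le> n" for i
    unfolding fps_compose_nth using that assms
    by (intro sum.mono_neutral_left) (auto simp: startsby_zero_power_prefix)
  then have "fps_nth ((a oo b) * c) n =
      (\<Sum>i=0..n. \<Sum>k=0..n. fps_nth a k * (fps_nth (b ^ k) i * fps_nth c (n - i)))"
    by (simp add: fps_mult_nth sum_distrib_right mult.assoc)
  also have "\<dots> = (\<Sum>k=0..n. fps_nth a k * fps_nth (b ^ k * c) n)"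
    by (subst sum.swap) (simp add: fps_mult_nth sum_distrib_left)
  finally show ?thesis .
qed

text \<open>\<open>Q\<close> is the polylogarithm divided by its variable, so the quotient by the
  nonzero \<open>u\<close> becomes a composition. The substitution of \<open>- fps_X\<close> is then
  common to both factors.\<close>

lemma deg_poly_Bernoulli_gf_eq:
  defines "Q \<equiv> \<lambda>p l. Abs_fps (\<lambda>k. (- l) ^ k * deg_ffact (1 / l) 1 (k + 1) /
      (fact k * real (k + 1) powi p))"
  shows "deg_poly_Bernoulli_gf p l x =
    ((Q p l oo (1 - deg_exp l 1)) * deg_exp l (- x)) oo (- fps_X)"
proof -
  define w where "w = 1 - deg_exp l 1"
  define u where "u = w oo (- fps_X)"
  have u: "u = 1 - (deg_exp l 1 oo (- fps_X))"
    by (simp add: u_def w_def fps_compose_sub_distrib)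
  have w0: "fps_nth w 0 = 0" by (simp add: w_def)
  then have u0: "fps_nth u 0 = 0" by (simp add: u_def)
  have "fps_nth u 1 = 1"
    by (simp add: u_def w_def fps_compose_uminus' deg_exp_def deg_ffact_def)
  then have "u \<noteq> 0" by auto
  have "deg_polylog p l = fps_X * Q p l"
    by (rule fps_ext) (auto simp: deg_polylog_def Q_def)
  then have "deg_polylog p l oo u = u * (Q p l oo u)"
    by (simp add: fps_compose_mult_distrib u0)
  then have "(deg_polylog p l oo u) / u = Q p l oo u"
    using \<open>u \<noteq> 0\<close> by simp
  also have "\<dots> = (Q p l oo w) oo (- fps_X)"
    unfolding u_def by (rule fps_compose_assoc) (simp_all add: w0)
  finally have "deg_poly_Bernoulli_gf p l x =
      ((Q p l oo w) oo (- fps_X)) * (deg_exp l (- x) oo (- fps_X))"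
    by (simp add: deg_poly_Bernoulli_gf_def flip: u)
  then show ?thesis
    by (simp add: fps_compose_mult_distrib w_def)
qed

text \<open>The outer sign comes from \<open>- fps_X\<close>. The signs of \<open>(- l) ^ k\<close>
  and \<open>(1 - deg_exp l 1) ^ k\<close> cancel, as do the factors \<open>fact k\<close>.\<close>

lemma deg_poly_Bernoulli_eq_sum_rStir:
  "deg_poly_Bernoulli p l n x =
     (-1) ^ n * (\<Sum>k=0..n. l ^ k * deg_ffact (1 / l) 1 (k + 1) / real (k + 1) powi p *
       rStir l (- x) n k)"
proof -
  define c where "c k = deg_ffact (1 / l) 1 (k + 1) / real (k + 1) powi p" for k
  have w: "fps_nth ((1 - deg_exp l 1) ^ k * deg_exp l (- x)) n =
      (-1) ^ k * (fact k * rStir l (- x) n k / fact n)" for k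
  proof -
    have "(1 - deg_exp l 1) ^ k = fps_const ((-1) ^ k) * (deg_exp l 1 - 1) ^ k"
      using power_minus[of "deg_exp l 1 - 1" k]
      by (simp add: fps_const_neg[symmetric] flip: fps_const_power del: fps_const_neg)
    then show ?thesis
      by (simp add: mult.assoc deg_exp_minus_one_power_nth)
  qed
  have "deg_poly_Bernoulli p l n x = fact n * ((-1) ^ n *
      (\<Sum>k=0..n. (- l) ^ k * deg_ffact (1 / l) 1 (k + 1) / (fact k * real (k + 1) powi p) *
        ((-1) ^ k * (fact k * rStir l (- x) n k / fact n))))"
    by (simp add: deg_poly_Bernoulli_def deg_poly_Bernoulli_gf_eq fps_compose_uminus'
        fps_compose_mult_nth w)
      (simp add: mult_ac)
  also have "\<dots> = fact n * ((-1) ^ n * (\<Sum>k=0..n. l ^ k * c k * rStir l (- x) n k / fact n))"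
  proof -
    have "(- l) ^ k * deg_ffact (1 / l) 1 (k + 1) / (fact k * real (k + 1) powi p) *
        ((-1) ^ k * (fact k * rStir l (- x) n k / fact n)) =
        l ^ k * c k * rStir l (- x) n k / fact n" for k
      by (simp add: c_def power_minus[of l])
    then show ?thesis by simp
  qed
  finally show ?thesis
    unfolding sum_divide_distrib[symmetric] by (simp add: c_def)
qed

theorem theorem10:
  fixes l :: real and p :: int and r n :: nat
  assumes "l \<noteq> 0"
  shows "deg_poly_Bernoulli p l n (- real r) =
           (-1) ^ n * (\<Sum>k=0..n. l ^ k * deg_ffact (1 / l) 1 (k + 1) / real (k + 1) powi p *
             (\<Sum>j=0..n. real (n choose j) * deg_Stirling2 l j k * deg_ffact l (real r) (n - j)))
       \<and> (-1) ^ n * (\<Sum>k=0..n. l ^ k * deg_ffact (1 / l) 1 (k + 1) / real (k + 1) powi p *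
             (\<Sum>j=0..n. real (n choose j) * deg_Stirling2 l j k * deg_ffact l (real r) (n - j)))
         = (-1) ^ n * (\<Sum>k=0..n. l ^ k * deg_ffact (1 / l) 1 (k + 1) / real (k + 1) powi p *
             deg_rStirling2 l r (n + r) (k + r))"
proof -
  \<comment> \<open>At \<open>x = - real r\<close> all three expressions share the inner term
    \<open>rStir l (real r) n k\<close>.\<close>
  have "(\<Sum>j=0..n. real (n choose j) * deg_Stirling2 l j k * deg_ffact l (real r) (n - j)) =
      rStir l (real r) n k" for k
    by (simp add: deg_Stirling2_eq_rStir rStir_eq_sum_binomial[of l "real r"])
  then show ?thesis
    by (simp add: deg_poly_Bernoulli_eq_sum_rStir deg_rStirling2_eq_rStir)
qed

end
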